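(* Let $\mathbf{a}=(a_1,\ldots,a_k)$ be an integer partition with $\Delta(\mathbf{a})<0$. Then the graph $G(\mathbf{a})$ does not have a Hamilton cycle, and it does not have a Hamilton path unless $\mathbf{a}=(2,1)$.
   Context: An integer partition is a sequence $\mathbf{a}=(a_1,\ldots,a_k)$ of integers with $k\geq 2$ and $a_1\geq a_2\geq\cdots\geq a_k\geq 1$; write $n:=a_1+\cdots+a_k$. An $\mathbf{a}$-multiset permutation is a string of length $n$ over the alphabet $\{1,\ldots,k\}$ containing exactly $a_i$ occurrences of the symbol $i$ for each $i$. The graph $G(\mathbf{a})$ has as vertices all $\mathbf{a}$-multiset permutations, and two of them are adjacent if one is obtained from the other by a star transposition, i.e., by swapping the first entry with an entry at some position $2,\ldots,n$ that is distinct from the first entry. Define $\Delta(\mathbf{a}):=n-2a_1$. *)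

theory Defs
  imports "Graph_Theory.Pair_Digraph"
begin

text \<open>
  The partition $(a_1,\ldots,a_k)$ is the list \<open>a\<close> of length \<open>k\<close>, so that $a_i$ is \<open>a ! (i - 1)\<close>.
\<close>

definition integer_partition :: "nat list \<Rightarrow> bool" where
  "integer_partition a \<longleftrightarrow> 2 \<le> length a \<and> sorted_wrt (\<ge>) a \<and> (\<forall>x\<in>set a. 1 \<le> x)"

definition Delta :: "nat list \<Rightarrow> int" where
  "Delta a = int (sum_list a) - 2 * int (a ! 0)"

definition multiset_perms :: "nat list \<Rightarrow> nat list set" where
  "multiset_perms a =
     {x. length x = sum_list a \<and> set x \<subseteq> {1..length a} \<and>
         (\<forall>i\<in>{1..length a}. count_list x i = a ! (i - 1))}"

text \<open>
  List positions start at 0, so the first entry of \<open>x\<close> is \<open>x ! 0\<close>, and positions $2,\ldots,n$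
  are the indices \<open>1, \<dots>, n - 1\<close>.
\<close>

definition star_transposition :: "nat list \<Rightarrow> nat list \<Rightarrow> bool" where
  "star_transposition x y \<longleftrightarrow>
     (\<exists>j\<in>{1..<length x}. x ! j \<noteq> x ! 0 \<and> y = x[0 := x ! j, j := x ! 0])"

text \<open>Undirected graphs are symmetric digraphs without loops and parallel arcs.\<close>

definition star_graph :: "nat list \<Rightarrow> nat list pair_pre_digraph" where
  "star_graph a =
     \<lparr> pverts = multiset_perms a,
       parcs = {(x, y). x \<in> multiset_perms a \<and> y \<in> multiset_perms a \<and> star_transposition x y} \<rparr>"

definition has_hamilton_path :: "('a, 'b) pre_digraph \<Rightarrow> bool" where
  "has_hamilton_path G \<longleftrightarrow>
     (\<exists>u p v. pre_digraph.apath G u p v \<and> set (pre_digraph.awalk_verts G u p) = verts G)"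

text \<open>
  In a symmetric digraph, the closed walk that goes back and forth along one edge satisfies
  \<^const>\<open>pre_digraph.cycle\<close>. It is not a cycle of the undirected graph, hence the bound on the length.
\<close>

definition has_hamilton_cycle :: "('a, 'b) pre_digraph \<Rightarrow> bool" where
  "has_hamilton_cycle G \<longleftrightarrow>
     (\<exists>c. pre_digraph.cycle G c \<and> 3 \<le> length c \<and> tail G ` set c = verts G)"

lemma star_transposition_sym:
  assumes "star_transposition x y"
  shows "star_transposition y x"
proof -
  obtain j where j: "1 \<le> j" "j < length x" "x ! j \<noteq> x ! 0"
    and y: "y = x[0 := x ! j, j := x ! 0]"
    using assms by (auto simp: star_transposition_def)
  have len: "length y = length x"
    by (simp add: y)
  have "0 < length x" "j \<noteq> 0"
    using j by linarith+
  then have y0: "y ! 0 = x ! j" and yj: "y ! j = x ! 0"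
    using j(2) by (simp_all add: y)
  have "x = y[0 := x ! 0, j := x ! j]"
  proof (rule nth_equalityI)
    show "x ! i = y[0 := x ! 0, j := x ! j] ! i" if "i < length x" for i
      using that j(2) by (cases "i = j"; cases "i = 0") (auto simp: y)
  qed (simp add: y)
  then show ?thesis
    unfolding star_transposition_def
    using j y0 yj len by (intro bexI[of _ j]) auto
qed

lemma finite_multiset_perms: "finite (multiset_perms a)"
  by (rule finite_subset[OF _ finite_lists_length_eq[of "{1..length a}" "sum_list a"]])
    (auto simp: multiset_perms_def)

lemma pair_graph_star_graph: "pair_graph (star_graph a)"
proof
  have "parcs (star_graph a) \<subseteq> multiset_perms a \<times> multiset_perms a"
    by (auto simp: star_graph_def)
  then show "finite (parcs (star_graph a))"
    using finite_multiset_perms finite_subset by blast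
  show "fst e \<noteq> snd e" if "e \<in> parcs (star_graph a)" for e
    using that by (auto simp: star_graph_def star_transposition_def)
      (metis length_list_update nth_list_update_eq nth_list_update_neq
        list.size(3) not_less_zero length_greater_0_conv not_one_le_zero)
qed (auto simp: star_graph_def finite_multiset_perms symmetric_def sym_def
      intro: star_transposition_sym)

end

theory Submission
  imports Defs "HOL-Combinatorics.Multiset_Permutations"
begin

text \<open>
  The permutations that start with 1 form an independent set, because a star transposition
  changes the first entry. They are the fraction $a_1/n > 1/2$ of all $N$ vertices, and
  an independent set contains at most half of the vertices of a Hamilton cycle and at most
  $(N+1)/2$ of the vertices of a Hamilton path. The latter bound gives $N(2a_1-n) \le n$, whereas
  $N \ge \binom{n}{a_1} \ge n$; hence $2a_1 = n+1$ and $\binom{n}{a_1} = n$, which forces $n = 3$.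
\<close>

section \<open>Independent sets and Hamilton cycles\<close>

text \<open>With \<open>f\<close> and \<open>g\<close> as tail and head, an arc has at most one end
  in \<open>S\<close>, so it is counted at most once on the left.\<close>

lemma length_filter_ends_le:
  assumes "\<And>e. e \<in> set p \<Longrightarrow> \<not> (f e \<in> S \<and> g e \<in> S)"
  shows "length (filter (\<lambda>e. f e \<in> S) p) + length (filter (\<lambda>e. g e \<in> S) p) \<le> length p"
  using assms by (induction p) fastforce+

lemma card_le_length_filter:
  assumes "S \<subseteq> f ` set p"
  shows "card S \<le> length (filter (\<lambda>e. f e \<in> S) p)"
proof -
  have "S \<subseteq> set (map f (filter (\<lambda>e. f e \<in> S) p))"
    using assms by auto
  then have "card S \<le> card (set (map f (filter (\<lambda>e. f e \<in> S) p)))"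
    by (intro card_mono) auto
  also have "\<dots> \<le> length (filter (\<lambda>e. f e \<in> S) p)"
    by (metis card_length length_map)
  finally show ?thesis .
qed

text \<open>On a path every vertex but the last is a tail and every vertex but the first is a head.
  The element \<open>v\<close> stands for that one exception, which costs the
  \<open>Suc\<close>.\<close>

lemma card_le_Suc_length_filter:
  assumes "S \<subseteq> insert v (f ` set p)"
  shows "card S \<le> Suc (length (filter (\<lambda>e. f e \<in> S) p))"
proof -
  have "S \<subseteq> insert v (set (map f (filter (\<lambda>e. f e \<in> S) p)))"
    using assms by auto
  then have "card S \<le> card (insert v (set (map f (filter (\<lambda>e. f e \<in> S) p))))"
    by (intro card_mono) auto
  also have "\<dots> \<le> Suc (card (set (map f (filter (\<lambda>e. f e \<in> S) p))))"
    by (simp add: card_insert_if)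
  also have "\<dots> \<le> Suc (length (filter (\<lambda>e. f e \<in> S) p))"
    by (metis Suc_le_mono card_length length_map)
  finally show ?thesis .
qed

text \<open>Double counting of arcs: at least \<open>card S - 1\<close> arcs of the path start in
  \<open>S\<close> and at least \<open>card S - 1\<close> end in \<open>S\<close>. By independence
  no arc does both, and the path has \<open>card (verts G) - 1\<close> arcs.\<close>

lemma card_independent_if_hamilton_path:
  assumes "has_hamilton_path G"
    and "S \<subseteq> verts G"
    and indep: "\<And>e. e \<in> arcs G \<Longrightarrow> \<not> (tail G e \<in> S \<and> head G e \<in> S)"
  shows "2 * card S \<le> card (verts G) + 1"
proof -
  obtain u p v where path: "pre_digraph.apath G u p v"
    and verts: "set (pre_digraph.awalk_verts G u p) = verts G"
    using assms(1) by (auto simp: has_hamilton_path_def)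
  note path = path[unfolded pre_digraph.apath_def pre_digraph.awalk_def]
  \<comment> \<open>The vertex list is read in two ways: as all tails followed by the last vertex,
    and as the first vertex followed by all heads. For \<open>p = []\<close> both reduce to
    \<open>[u]\<close>.\<close>
  note tails = pre_digraph.awalk_verts_conv[of G u p]
  have heads: "pre_digraph.awalk_verts G u p
      = (if p = [] then [u] else tail G (hd p) # map (head G) p)"
    using path by (intro pre_digraph.awalk_verts_conv') auto
  have "S \<subseteq> insert (if p = [] then u else head G (last p)) (tail G ` set p)"
    using assms(2) verts tails by (auto split: if_splits)
  then have "card S \<le> Suc (length (filter (\<lambda>e. tail G e \<in> S) p))"
    by (rule card_le_Suc_length_filter)
  moreover have "S \<subseteq> insert (if p = [] then u else tail G (hd p)) (head G ` set p)"
    using assms(2) verts heads by (auto split: if_splits)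
  then have "card S \<le> Suc (length (filter (\<lambda>e. head G e \<in> S) p))"
    by (rule card_le_Suc_length_filter)
  moreover have "length (filter (\<lambda>e. tail G e \<in> S) p) + length (filter (\<lambda>e. head G e \<in> S) p)
      \<le> length p"
    using path indep by (intro length_filter_ends_le) auto
  moreover have "card (verts G) = Suc (length p)"
  proof -
    have "length (pre_digraph.awalk_verts G u p) = Suc (length p)"
      using tails by simp
    then show ?thesis using path verts by (metis distinct_card)
  qed
  ultimately show ?thesis by linarith
qed

text \<open>The same count as for paths, but on a cycle every vertex is both a tail and a head, so
  there are no exceptions and the additive 1 disappears.\<close>

lemma card_independent_if_hamilton_cycle:
  assumes "has_hamilton_cycle G"
    and "S \<subseteq> verts G"
    and indep: "\<And>e. e \<in> arcs G \<Longrightarrow> \<not> (tail G e \<in> S \<and> head G e \<in> S)"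
  shows "2 * card S \<le> card (verts G)"
proof -
  obtain p where cycle: "pre_digraph.cycle G p" and verts: "tail G ` set p = verts G"
    using assms(1) by (auto simp: has_hamilton_cycle_def)
  then obtain u where arcs: "set p \<subseteq> arcs G" and cas: "pre_digraph.cas G u p u"
    and dist: "distinct (tl (pre_digraph.awalk_verts G u p))" and ne: "p \<noteq> []"
    by (auto simp: pre_digraph.cycle_def pre_digraph.awalk_def)
  have heads: "pre_digraph.awalk_verts G u p = u # map (head G) p"
    using pre_digraph.awalk_verts_conv'[OF cas] pre_digraph.cas_simp[OF ne] cas ne by metis
  have tails: "pre_digraph.awalk_verts G u p = map (tail G) p @ [head G (last p)]"
    using pre_digraph.awalk_verts_conv[of G u p] ne by simp
  have "head G (last p) = u"
  proof -
    have "pre_digraph.cas G w q v \<Longrightarrow> q \<noteq> [] \<Longrightarrow> head G (last q) = v" for w q v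
      by (induction q arbitrary: w) (auto simp: pre_digraph.cas.simps)
    then show ?thesis using cas ne by blast
  qed
  \<comment> \<open>The closed walk lists \<open>u\<close> at both ends. Cancelling it shows that
    heads and tails agree as multisets, which carries the covering property from tails to heads;
    distinctness is known for heads.\<close>
  then have "mset (u # map (head G) p) = mset (u # map (tail G) p)"
    using heads tails by (metis mset.simps(2) mset_append union_code add_mset_add_single mset.simps(1))
  then have eq: "mset (map (head G) p) = mset (map (tail G) p)"
    by simp
  then have sets: "head G ` set p = verts G"
    using verts by (metis mset_eq_setD set_map)
  have "distinct (map (head G) p)"
    using dist heads by simp
  then have "card (verts G) = length p"
    using sets by (metis distinct_card length_map set_map)
  moreover have "card S \<le> length (filter (\<lambda>e. tail G e \<in> S) p)"
    "card S \<le> length (filter (\<lambda>e. head G e \<in> S) p)"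
    using assms(2) verts sets by (auto intro!: card_le_length_filter)
  moreover have "length (filter (\<lambda>e. tail G e \<in> S) p) + length (filter (\<lambda>e. head G e \<in> S) p)
      \<le> length p"
    using arcs indep by (intro length_filter_ends_le) auto
  ultimately show ?thesis by linarith
qed

section \<open>Counting multiset permutations\<close>

text \<open>Every choice of positions for \<open>x\<close> extends to a permutation. Formally,
  remove a copy of some \<open>y\<close> other than \<open>x\<close>: the absorption identity for
  binomials matches the recurrence for the number of permutations, since \<open>count M y\<close> is
  at most \<open>size M - count M x\<close>. If \<open>M\<close> contains only \<open>x\<close>, the
  binomial is 1.\<close>

lemma binomial_le_card_permutations_of_multiset:
  "size M choose count M x \<le> card (permutations_of_multiset M)"
proof (induction "size M" arbitrary: M)
  case 0
  then show ?case by simp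
next
  case (Suc n)
  show ?case
  proof (cases "\<exists>y. y \<in># M \<and> y \<noteq> x")
    case True
    then obtain y where y: "y \<in># M" "y \<noteq> x" by blast
    have size: "size (M - {#y#}) = n"
      using y Suc.hyps(2) by (simp add: size_Diff_singleton)
    have "count M x + count M y \<le> size M"
    proof -
      have "replicate_mset (count M x) x + replicate_mset (count M y) y \<subseteq># M"
        using y by (auto simp: subseteq_mset_def)
      then show ?thesis by (auto dest: size_mset_mono)
    qed
    then have le: "count M y \<le> size M - count M x" by simp
    have "(size M - count M x) * (size M choose count M x)
        = size M * ((size M - 1) choose count M x)"
      by (rule binomial_absorb_comp)
    also have "\<dots> \<le> size M * card (permutations_of_multiset (M - {#y#}))"
    proof (rule mult_left_mono)
      show "size M - 1 choose count M x \<le> card (permutations_of_multiset (M - {#y#}))"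
        using Suc.hyps(1)[of "M - {#y#}"] size y(2) by (simp flip: Suc.hyps(2))
    qed simp
    also have "\<dots> = card (permutations_of_multiset M) * count M y"
      using card_permutations_of_multiset_remove_aux[OF y(1)] by simp
    also have "\<dots> \<le> (size M - count M x) * card (permutations_of_multiset M)"
      using le by simp
    finally show ?thesis
      using le y(1) by (metis count_greater_zero_iff less_le_trans mult_le_cancel1)
  next
    case False
    then have "set_mset M \<subseteq> {x}" by blast
    then have "M = replicate_mset (count M x) x"
      by (metis set_mset_subset_singletonD count_replicate_mset)
    then have "count M x = size M" by (metis size_replicate_mset)
    then show ?thesis
      by (simp add: Suc_le_eq card_gt_0_iff)
  qed
qed

text \<open>Transfers the library's counting results. The multiset is supplied by a member
  \<open>x\<close>, which exists as soon as the graph has a Hamilton path or cycle.\<close>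

lemma multiset_perms_eq_permutations_of_multiset:
  assumes "x \<in> multiset_perms a"
  shows "multiset_perms a = permutations_of_multiset (mset x)"
proof -
  have "y \<in> multiset_perms a \<longleftrightarrow> mset y = mset x" for y
  proof
    assume y: "y \<in> multiset_perms a"
    show "mset y = mset x"
    proof (rule multiset_eqI)
      fix i
      show "count (mset y) i = count (mset x) i"
      proof (cases "i \<in> {1..length a}")
        case True
        then show ?thesis using assms y by (simp add: multiset_perms_def count_mset)
      next
        case False
        then have "i \<notin> set x" "i \<notin> set y"
          using assms y by (auto simp: multiset_perms_def)
        then show ?thesis by (simp add: count_mset)
      qed
    qed
  next
    assume eq: "mset y = mset x"
    then have "set y = set x" "length y = length x" "count_list y = count_list x"
      by (auto dest: mset_eq_setD mset_eq_length simp flip: count_mset)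
    then show "y \<in> multiset_perms a"
      using assms by (simp add: multiset_perms_def)
  qed
  then show ?thesis by (auto simp: permutations_of_multiset_def)
qed

text \<open>Deleting the leading \<open>c\<close> is a bijection onto the permutations of
  \<open>M - {#c#}\<close>.\<close>

lemma card_permutations_of_multiset_hd:
  assumes "c \<in># M"
  shows "size M * card {x \<in> permutations_of_multiset M. x ! 0 = c}
    = count M c * card (permutations_of_multiset M)"
proof -
  have "{x \<in> permutations_of_multiset M. x ! 0 = c}
      = (#) c ` permutations_of_multiset (M - {#c#})" (is "?L = ?R")
  proof
    show "?L \<subseteq> ?R"
    proof
      fix x assume x: "x \<in> ?L"
      then obtain d ys where "x = d # ys"
        using assms by (cases x) (auto simp: permutations_of_multiset_def)
      then show "x \<in> ?R" using x by (auto simp: permutations_of_multiset_Cons_iff)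
    qed
    show "?R \<subseteq> ?L" using assms by (auto simp: permutations_of_multiset_Cons_iff)
  qed
  then have "card {x \<in> permutations_of_multiset M. x ! 0 = c}
      = card (permutations_of_multiset (M - {#c#}))"
    by (simp add: card_image)
  then show ?thesis
    using card_permutations_of_multiset_remove_aux[OF assms] by (simp add: mult.commute)
qed

section \<open>The star transposition graph\<close>

lemma star_transposition_nth_0:
  assumes "star_transposition x y"
  shows "y ! 0 \<noteq> x ! 0"
proof -
  obtain j where j: "1 \<le> j" "j < length x" "x ! j \<noteq> x ! 0" "y = x[0 := x ! j, j := x ! 0]"
    using assms by (auto simp: star_transposition_def)
  then have "y ! 0 = x ! j" by (metis gr0I list_update_swap nth_list_update_eq
        length_list_update not_one_le_zero order.strict_trans)
  then show ?thesis using j by simp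
qed

lemma star_graph_independent:
  assumes "e \<in> arcs (with_proj (star_graph a))"
  shows "\<not> (tail (with_proj (star_graph a)) e \<in> {x \<in> multiset_perms a. x ! 0 = c} \<and>
            head (with_proj (star_graph a)) e \<in> {x \<in> multiset_perms a. x ! 0 = c})"
  using assms star_transposition_nth_0 by (fastforce simp: star_graph_def)

lemma card_multiset_perms:
  assumes "multiset_perms a \<noteq> {}" and "a \<noteq> []" and "1 \<le> a ! 0"
  shows "sum_list a * card {x \<in> multiset_perms a. x ! 0 = 1} = a ! 0 * card (multiset_perms a)"
    and "sum_list a choose (a ! 0) \<le> card (multiset_perms a)"
    and "0 < card (multiset_perms a)"
proof -
  obtain x where x: "x \<in> multiset_perms a" using assms(1) by blast
  have "1 \<in> {1..length a}" using assms(2) by (cases a) auto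
  then have "count (mset x) 1 = a ! 0" "size (mset x) = sum_list a"
    using x by (auto simp: multiset_perms_def count_mset)
  moreover from this have "1 \<in># mset x"
    using assms(3) by (metis count_greater_eq_one_iff)
  ultimately show
    "sum_list a * card {x \<in> multiset_perms a. x ! 0 = 1} = a ! 0 * card (multiset_perms a)"
    "sum_list a choose (a ! 0) \<le> card (multiset_perms a)"
    using card_permutations_of_multiset_hd[of 1 "mset x"]
      binomial_le_card_permutations_of_multiset[of "mset x" 1]
    by (simp_all add: multiset_perms_eq_permutations_of_multiset[OF x])
  show "0 < card (multiset_perms a)"
    using assms(1) by (simp add: card_gt_0_iff finite_multiset_perms)
qed

text \<open>Here \<open>m\<close> is the largest part and \<open>N\<close> the number of vertices.
  The last assumption is the path bound multiplied by \<open>n\<close>, with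
  \<open>n * card S\<close> replaced by \<open>m * N\<close>.\<close>

lemma binomial_majority_small:
  fixes m n N :: nat
  assumes "m < n" and "n < 2 * m" and "n choose m \<le> N" and "2 * m * N \<le> n * (N + 1)"
  shows "m = 2 \<and> n = 3"
proof -
  have sym: "n choose m = n choose (n - m)"
    using assms(1) by (intro binomial_symmetric) simp
  \<comment> \<open>As \<open>m\<close> exceeds half of \<open>n\<close>, the index
    \<open>n - m\<close> lies between 1 and \<open>n / 2\<close>, where binomials increase.\<close>
  have "n choose 1 \<le> n choose (n - m)"
    using assms by (intro binomial_mono) auto
  then have "n \<le> N" using sym assms(3) by simp
  obtain d where d: "2 * m = n + d" using assms(2) by (metis less_imp_add_positive)
  then have dN: "d * N \<le> n" using assms(4) by (simp add: algebra_simps)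
  have "d = 1"
  proof (rule ccontr)
    assume "d \<noteq> 1"
    then have "2 * N \<le> d * N" using d assms(2) by (intro mult_right_mono) auto
    then show False using dN \<open>n \<le> N\<close> assms(1) by linarith
  qed
  then have "N = n" using dN \<open>n \<le> N\<close> by simp
  \<comment> \<open>Now \<open>n = 2 * m - 1\<close> and \<open>n choose m \<le> n\<close>. For
    larger \<open>m\<close> the index \<open>n - m\<close> is at least 2, and
    \<open>n choose 2\<close> already exceeds \<open>n\<close> from \<open>n = 5\<close> on.\<close>
  have "m < 3"
  proof (rule ccontr)
    assume "\<not> m < 3"
    then have "n \<ge> 5" "2 \<le> n - m" "2 * (n - m) \<le> n" using d \<open>d = 1\<close> by auto
    then have "n choose 2 \<le> N"
      using sym assms(3) binomial_mono[of 2 "n - m" n] by simp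
    moreover have "n * 4 \<le> n * (n - 1)" using \<open>n \<ge> 5\<close> by (intro mult_left_mono) auto
    then have "n * 2 \<le> n * (n - 1) div 2" by linarith
    then have "n < n choose 2" using \<open>n \<ge> 5\<close> by (simp add: choose_two)
    ultimately show False using \<open>N = n\<close> by simp
  qed
  then show ?thesis using d \<open>d = 1\<close> assms(1) by auto
qed

section \<open>The exceptional partition (2,1)\<close>

lemma multiset_perms_2_1: "multiset_perms [2, 1] = {[1, 1, 2], [2, 1, 1], [1, 2, 1]}"
proof
  show "multiset_perms [2, 1] \<subseteq> {[1, 1, 2], [2, 1, 1], [1, 2, 1]}"
  proof
    fix x assume x: "x \<in> multiset_perms [2, 1]"
    then have "length x = Suc (Suc (Suc 0))" by (simp add: multiset_perms_def)
    then obtain p q r where pqr: "x = [p, q, r]" by (auto simp: length_Suc_conv)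
    have 12: "{1..length [2, 1 :: nat]} = {1, 2}" by auto
    have "{p, q, r} \<subseteq> {1, 2}" "count_list [p, q, r] 1 = 2"
      using x unfolding multiset_perms_def pqr 12 by auto
    then show "x \<in> {[1, 1, 2], [2, 1, 1], [1, 2, 1]}"
      unfolding pqr by (auto split: if_splits)
  qed
  have 12: "{1..Suc (Suc 0)} = {1, 2}" by auto
  show "{[1, 1, 2], [2, 1, 1], [1, 2, 1]} \<subseteq> multiset_perms [2, 1]"
    by (simp add: multiset_perms_def 12)
qed

text \<open>The graph is itself a path on three vertices, with 211 adjacent to both 112 and
  121.\<close>

lemma has_hamilton_path_2_1: "has_hamilton_path (with_proj (star_graph [2, 1]))"
proof -
  have "star_transposition [1, 1, 2] [2, 1, 1]"
    unfolding star_transposition_def by (intro bexI[of _ 2]) auto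
  moreover have "star_transposition [2, 1, 1] [1, 2, 1]"
    unfolding star_transposition_def by (intro bexI[of _ 1]) auto
  ultimately show ?thesis
    unfolding has_hamilton_path_def pre_digraph.apath_def pre_digraph.awalk_def
    by (intro exI[of _ "[1, 1, 2]"]
        exI[of _ "[([1, 1, 2], [2, 1, 1]), ([2, 1, 1], [1, 2, 1])]"] exI[of _ "[1, 2, 1]"])
      (simp add: star_graph_def multiset_perms_2_1[simplified] pre_digraph.cas.simps
        pre_digraph.awalk_verts.simps)
qed

theorem theorem4:
  fixes a :: "nat list"
  assumes "integer_partition a"
    and "Delta a < 0"
  shows "\<not> has_hamilton_cycle (with_proj (star_graph a)) \<and>
         (has_hamilton_path (with_proj (star_graph a)) \<longleftrightarrow> a = [2, 1])"
proof -
  define V where "V = multiset_perms a"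
  define S where "S = {x \<in> V. x ! 0 = 1}"
  have verts: "verts (with_proj (star_graph a)) = V"
    by (simp add: star_graph_def V_def)
  obtain a1 a2 r where a: "a = a1 # a2 # r"
    using assms(1) by (cases a rule: remdups_adj.cases) (auto simp: integer_partition_def)
  have pos: "1 \<le> a1" "1 \<le> a2" "\<forall>x \<in> set r. 1 \<le> x"
    using assms(1) by (auto simp: a integer_partition_def)
  have lt: "a1 < sum_list a" and maj: "sum_list a < 2 * a1"
    using pos assms(2) by (auto simp: a Delta_def)
  have indep: "\<not> (tail (with_proj (star_graph a)) e \<in> S \<and> head (with_proj (star_graph a)) e \<in> S)"
    if "e \<in> arcs (with_proj (star_graph a))" for e
    using star_graph_independent[OF that] by (simp add: S_def V_def)
  have count: "sum_list a * card S = a1 * card V" "sum_list a choose a1 \<le> card V" "0 < card V"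
    if "V \<noteq> {}"
    using card_multiset_perms[of a] that pos by (auto simp: S_def V_def a)
  have "\<not> has_hamilton_cycle (with_proj (star_graph a))"
  proof
    assume H: "has_hamilton_cycle (with_proj (star_graph a))"
    then have "V \<noteq> {}" by (auto simp: has_hamilton_cycle_def verts[symmetric])
    have "2 * card S \<le> card V"
      using card_independent_if_hamilton_cycle[OF H _ indep] verts by (auto simp: S_def)
    \<comment> \<open>Multiplying by \<open>sum_list a\<close> allows \<open>card S\<close> to be
      eliminated without division.\<close>
    then have "sum_list a * (2 * card S) \<le> sum_list a * card V" by (rule mult_left_mono) simp
    then have "2 * a1 * card V \<le> sum_list a * card V"
      using count(1)[OF \<open>V \<noteq> {}\<close>] by (metis mult.assoc mult.left_commute)
    then show False using count(3)[OF \<open>V \<noteq> {}\<close>] maj by simp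
  qed
  moreover have "a = [2, 1]" if H: "has_hamilton_path (with_proj (star_graph a))"
  proof -
    have "V \<noteq> {}"
      using H verts
      by (auto simp: has_hamilton_path_def pre_digraph.apath_def pre_digraph.awalk_def)
    have "2 * card S \<le> card V + 1"
      using card_independent_if_hamilton_path[OF H _ indep] verts by (auto simp: S_def)
    then have "sum_list a * (2 * card S) \<le> sum_list a * (card V + 1)" by (rule mult_left_mono) simp
    then have "2 * a1 * card V \<le> sum_list a * (card V + 1)"
      using count(1)[OF \<open>V \<noteq> {}\<close>] by (metis mult.assoc mult.left_commute)
    then have "a1 = 2" "sum_list a = 3"
      using binomial_majority_small[OF lt maj count(2)[OF \<open>V \<noteq> {}\<close>]] by auto
    then have "a2 + sum_list r = 1" by (simp add: a)
    then have "a2 = 1" "sum_list r = 0" using pos(2) by linarith+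
    then have "r = []" using pos(3) by (cases r) auto
    then show ?thesis using \<open>a1 = 2\<close> \<open>a2 = 1\<close> a by simp
  qed
  ultimately show ?thesis using has_hamilton_path_2_1 by blast
qed

end
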